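(* Let $\alpha>0$. All flat left invariant metrics on $\mathrm{E}(2)$ are fixed points for the $\mathrm{RG}$-$2$ flow with coupling constant $\alpha$ (and are thus trivial steady algebraic solitons). Furthermore, the flat metrics on $\mathrm{E}(2)$ are the only left invariant steady algebraic solitons for the $\mathrm{RG}$-$2$ flow on $\mathrm{E}(2)$.
   Context: $\mathrm{E}(2)$ is the simply connected three-dimensional Lie group (of orientation preserving isometries of the Euclidean plane, up to covering) whose Lie algebra $\mathfrak{h}$ has a basis $\mathbf{e}_1,\mathbf{e}_2,\mathbf{e}_3$ with non-zero brackets $[\mathbf{e}_2,\mathbf{e}_3]=\mathbf{e}_1$, $[\mathbf{e}_3,\mathbf{e}_1]=\mathbf{e}_2$. The $\mathrm{RG}$-$2$ flow with coupling constant $\alpha$ is $\frac{\partial\mathbf{g}}{\partial t}=\mathbf{RG}[\mathbf{g}]:=-2\mathbf{Rc}[\mathbf{g}]-\frac{\alpha}{2}\mathbf{Rm}^{2}[\mathbf{g}]$, where $\mathbf{Rc}[\mathbf{g}]$ is the Ricci tensor and $\mathbf{Rm}^{2}[\mathbf{g}]$ has components $\check{R}_{ij}=Rm_{iklm}Rm_{jpqr}g^{kp}g^{lq}g^{mr}$, with $Rm_{ijkl}$ the Riemannian curvature tensor of $\mathbf{g}$. A metric is a fixed point if $\mathbf{RG}[\mathbf{g}]=0$. The operator $\widehat{\mathbf{RG}[\mathbf{g}]}:\mathfrak{h}\to\mathfrak{h}$ is defined by $\mathbf{g}(\widehat{\mathbf{RG}[\mathbf{g}]}(X),Y)=\mathbf{RG}[\mathbf{g}](X,Y)$.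 A left invariant metric $\mathbf{g}$ is a steady algebraic soliton for the flow if $\widehat{\mathbf{RG}[\mathbf{g}]}$ is a derivation of $\mathfrak{h}$ (i.e. $\widehat{\mathbf{RG}[\mathbf{g}]}-\kappa\,\mathrm{Id}$ is a derivation with $\kappa=0$). *)

theory Defs
  imports "HOL-Analysis.Analysis"
begin

section \<open>Riemannian metrics and curvature in a global chart\<close>

definition pderiv_at :: "'n::finite \<Rightarrow> (real^'n \<Rightarrow> real) \<Rightarrow> real^'n \<Rightarrow> real" where
  "pderiv_at i f x = frechet_derivative f (at x) (axis i 1)"

text \<open>A function is of class \<open>C\<^sup>\<infinity>\<close> iff it is differentiable everywhere and all its partial
  derivatives are again of class \<open>C\<^sup>\<infinity>\<close>; this is the largest predicate with that property.\<close>

coinductive smooth_fun :: "(real^'n::finite \<Rightarrow> real) \<Rightarrow> bool" where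
  "\<lbrakk>\<And>x. f differentiable (at x); \<And>i. smooth_fun (pderiv_at i f)\<rbrakk> \<Longrightarrow> smooth_fun f"

text \<open>A metric on \<open>real^'n\<close>, regarded as a manifold with one global chart, is given by its
  coordinate components \<open>g x $ i $ j\<close>, i.e. its value on the \<open>i\<close>-th and \<open>j\<close>-th coordinate fields.\<close>

type_synonym 'n metric = "real^'n \<Rightarrow> real^'n^'n"

text \<open>The value on \<open>u\<close>, \<open>v\<close> of the bilinear form with component matrix \<open>A\<close>.\<close>

definition bform :: "real^'n^'n \<Rightarrow> real^'n \<Rightarrow> real^'n \<Rightarrow> real" where
  "bform A u v = (\<Sum>i\<in>UNIV. \<Sum>j\<in>UNIV. A $ i $ j * u $ i * v $ j)"

definition riemannian_metric :: "('n::finite) metric \<Rightarrow> bool" where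
  "riemannian_metric g \<longleftrightarrow>
     (\<forall>i j. smooth_fun (\<lambda>x. g x $ i $ j)) \<and>
     (\<forall>x u v. bform (g x) u v = bform (g x) v u) \<and>
     (\<forall>x u. u \<noteq> 0 \<longrightarrow> 0 < bform (g x) u u)"

definition ginv :: "('n::finite) metric \<Rightarrow> real^'n \<Rightarrow> 'n \<Rightarrow> 'n \<Rightarrow> real" where
  "ginv g x i j = matrix_inv (g x) $ i $ j"

text \<open>\<open>christoffel g k i j\<close> is the function \<open>\<Gamma>\<^sup>k\<^sub>i\<^sub>j\<close>.\<close>

definition christoffel :: "('n::finite) metric \<Rightarrow> 'n \<Rightarrow> 'n \<Rightarrow> 'n \<Rightarrow> real^'n \<Rightarrow> real" where
  "christoffel g k i j x = (1/2) * (\<Sum>l\<in>UNIV. ginv g x k l *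
     (pderiv_at i (\<lambda>y. g y $ j $ l) x + pderiv_at j (\<lambda>y. g y $ i $ l) x
       - pderiv_at l (\<lambda>y. g y $ i $ j) x))"

text \<open>\<open>riemann_up g i j k l\<close> is the \<open>\<partial>\<^sub>l\<close>-component of
  \<open>R(\<partial>\<^sub>i,\<partial>\<^sub>j)\<partial>\<^sub>k = \<nabla>\<^sub>i\<nabla>\<^sub>j\<partial>\<^sub>k - \<nabla>\<^sub>j\<nabla>\<^sub>i\<partial>\<^sub>k\<close>, and \<open>Rm g x i j k l\<close> is
  \<open>g(R(\<partial>\<^sub>i,\<partial>\<^sub>j)\<partial>\<^sub>k, \<partial>\<^sub>l)\<close>.  The Ricci tensor is contracted so that round
  spheres have positive Ricci curvature.\<close>

definition riemann_up ::
    "('n::finite) metric \<Rightarrow> 'n \<Rightarrow> 'n \<Rightarrow> 'n \<Rightarrow> 'n \<Rightarrow> real^'n \<Rightarrow> real" where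
  "riemann_up g i j k l x =
     pderiv_at i (christoffel g l j k) x - pderiv_at j (christoffel g l i k) x
     + (\<Sum>m\<in>UNIV. christoffel g m j k x * christoffel g l i m x
                  - christoffel g m i k x * christoffel g l j m x)"

definition Rm :: "('n::finite) metric \<Rightarrow> real^'n \<Rightarrow> 'n \<Rightarrow> 'n \<Rightarrow> 'n \<Rightarrow> 'n \<Rightarrow> real" where
  "Rm g x i j k l = (\<Sum>m\<in>UNIV. riemann_up g i j k m x * g x $ m $ l)"

definition flat :: "('n::finite) metric \<Rightarrow> bool" where
  "flat g \<longleftrightarrow> (\<forall>x i j k l. Rm g x i j k l = 0)"

definition Rc :: "('n::finite) metric \<Rightarrow> real^'n \<Rightarrow> real^'n^'n" where
  "Rc g x = (\<chi> j k. \<Sum>i\<in>UNIV. riemann_up g i j k i x)"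

definition Rm2 :: "('n::finite) metric \<Rightarrow> real^'n \<Rightarrow> real^'n^'n" where
  "Rm2 g x = (\<chi> i j. \<Sum>k\<in>UNIV. \<Sum>l\<in>UNIV. \<Sum>m\<in>UNIV. \<Sum>p\<in>UNIV. \<Sum>q\<in>UNIV. \<Sum>r\<in>UNIV.
     Rm g x i k l m * Rm g x j p q r * ginv g x k p * ginv g x l q * ginv g x m r)"

definition RG :: "real \<Rightarrow> ('n::finite) metric \<Rightarrow> real^'n \<Rightarrow> real^'n^'n" where
  "RG \<alpha> g x = - 2 *\<^sub>R Rc g x - (\<alpha>/2) *\<^sub>R Rm2 g x"

definition RG2_fixed_point :: "real \<Rightarrow> ('n::finite) metric \<Rightarrow> bool" where
  "RG2_fixed_point \<alpha> g \<longleftrightarrow> (\<forall>x. RG \<alpha> g x = 0)"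

definition vf_bracket :: "(real^'n::finite \<Rightarrow> real^'n) \<Rightarrow> (real^'n \<Rightarrow> real^'n) \<Rightarrow> real^'n \<Rightarrow> real^'n" where
  "vf_bracket X Y p = frechet_derivative Y (at p) (X p) - frechet_derivative X (at p) (Y p)"


section \<open>The simply connected group E(2)\<close>

text \<open>The universal cover of the group of orientation preserving isometries of the Euclidean plane:
  \<open>(x, y, \<theta>)\<close> covers the isometry which rotates by \<open>\<theta>\<close> and then translates by \<open>(x, y)\<close>.  As a
  manifold it is \<open>real^3\<close>, so the identity map is a global chart.  The neutral element is \<open>0\<close>.\<close>

definition E2_mult :: "real^3 \<Rightarrow> real^3 \<Rightarrow> real^3" where
  "E2_mult p q = vector
     [p $ 1 + cos (p $ 3) * q $ 1 - sin (p $ 3) * q $ 2,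
      p $ 2 + sin (p $ 3) * q $ 1 + cos (p $ 3) * q $ 2,
      p $ 3 + q $ 3]"

text \<open>\<open>E2_dL a p\<close> is the differential at \<open>p\<close> of left translation by \<open>a\<close>.\<close>

definition E2_dL :: "real^3 \<Rightarrow> real^3 \<Rightarrow> real^3 \<Rightarrow> real^3" where
  "E2_dL a p = frechet_derivative (E2_mult a) (at p)"

definition E2_left_invariant_metric :: "3 metric \<Rightarrow> bool" where
  "E2_left_invariant_metric g \<longleftrightarrow> riemannian_metric g \<and>
     (\<forall>a p u v. bform (g (E2_mult a p)) (E2_dL a p u) (E2_dL a p v) = bform (g p) u v)"

text \<open>The Lie algebra of E(2) is the tangent space \<open>real^3\<close> at the neutral element; an element \<open>u\<close>
  corresponds to the left invariant vector field \<open>E2_field u\<close> with value \<open>u\<close> at \<open>0\<close>.\<close>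

definition E2_field :: "real^3 \<Rightarrow> real^3 \<Rightarrow> real^3" where
  "E2_field u p = E2_dL p 0 u"

definition E2_lie :: "real^3 \<Rightarrow> real^3 \<Rightarrow> real^3" where
  "E2_lie u v = vf_bracket (E2_field u) (E2_field v) 0"

definition E2_derivation :: "(real^3 \<Rightarrow> real^3) \<Rightarrow> bool" where
  "E2_derivation D \<longleftrightarrow> linear D \<and>
     (\<forall>u v. D (E2_lie u v) = E2_lie (D u) v + E2_lie u (D v))"

text \<open>The endomorphism of the Lie algebra dual to \<open>RG\<close>; the description is proper for every
  Riemannian metric, see \<open>RG_hat_eq\<close> below.\<close>

definition RG_hat :: "real \<Rightarrow> 3 metric \<Rightarrow> real^3 \<Rightarrow> real^3" where
  "RG_hat \<alpha> g u = (THE w. \<forall>v. bform (g 0) w v = bform (RG \<alpha> g 0) u v)"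

definition E2_algebraic_soliton :: "real \<Rightarrow> real \<Rightarrow> 3 metric \<Rightarrow> bool" where
  "E2_algebraic_soliton \<alpha> \<kappa> g \<longleftrightarrow> E2_derivation (\<lambda>u. RG_hat \<alpha> g u - \<kappa> *\<^sub>R u)"

definition E2_steady_algebraic_soliton :: "real \<Rightarrow> 3 metric \<Rightarrow> bool" where
  "E2_steady_algebraic_soliton \<alpha> g \<longleftrightarrow> E2_algebraic_soliton \<alpha> 0 g"


section \<open>Consistency of the definitions\<close>

lemma E2_mult_assoc: "E2_mult (E2_mult p q) r = E2_mult p (E2_mult q r)"
  by (simp add: E2_mult_def vec_eq_iff forall_3 cos_add sin_add algebra_simps)

lemma E2_mult_0: "E2_mult 0 p = p" "E2_mult p 0 = p"
  by (simp_all add: E2_mult_def vec_eq_iff forall_3)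

lemma E2_mult_left_inverse: "\<exists>q. E2_mult q p = 0"
proof
  show "E2_mult (vector [- cos (p$3) * p$1 - sin (p$3) * p$2,
                         sin (p$3) * p$1 - cos (p$3) * p$2, - p$3]) p = 0"
    by (simp add: E2_mult_def vec_eq_iff forall_3)
qed

lemma E2_dL_eq:
  "E2_dL a p u = vector [cos (a$3) * u$1 - sin (a$3) * u$2, sin (a$3) * u$1 + cos (a$3) * u$2, u$3]"
proof -
  let ?D = "\<lambda>u::real^3. vector [cos (a$3) * u$1 - sin (a$3) * u$2,
                                sin (a$3) * u$1 + cos (a$3) * u$2, u$3] :: real^3"
  have lin: "linear ?D"
    by (rule linearI) (simp_all add: vec_eq_iff forall_3 algebra_simps)
  have "E2_mult a = (\<lambda>q. a + ?D q)"
    by (rule ext) (simp add: E2_mult_def vec_eq_iff forall_3)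
  moreover have "((\<lambda>q. a + ?D q) has_derivative ?D) (at p)"
    using has_derivative_add[OF has_derivative_const[of a]
        linear_imp_has_derivative[OF lin, of "at p"]] by simp
  ultimately have "(E2_mult a has_derivative ?D) (at p)" by simp
  from frechet_derivative_at[OF this, symmetric] show ?thesis
    unfolding E2_dL_def by (rule fun_cong)
qed

lemma E2_field_has_derivative:
  "(E2_field u has_derivative (\<lambda>h. h$3 *\<^sub>R vector [- u$2, u$1, 0])) (at 0)"
proof (rule has_derivative_componentwise_within[THEN iffD2], rule ballI)
  fix b :: "real^3" assume "b \<in> Basis"
  then consider "b = axis 1 1" | "b = axis 2 1" | "b = axis 3 1"
    unfolding axis_in_Basis_iff Basis_vec_def by (auto simp: UNIV_3)
  moreover have "((\<lambda>x. x $ 3) has_derivative (\<lambda>x. x $ 3)) (at (0::real^3))"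
    by (rule bounded_linear_imp_has_derivative[OF bounded_linear_vec_nth])
  ultimately show "((\<lambda>x. E2_field u x \<bullet> b) has_derivative
      (\<lambda>h. (h$3 *\<^sub>R vector [- u$2, u$1, 0]) \<bullet> b)) (at 0)"
    by cases (auto simp: E2_field_def E2_dL_eq inner_axis intro!: derivative_eq_intros)
qed

lemma E2_lie_eq: "E2_lie u v = vector [u$2 * v$3 - u$3 * v$2, u$3 * v$1 - u$1 * v$3, 0]"
  unfolding E2_lie_def vf_bracket_def
    frechet_derivative_at[OF E2_field_has_derivative, symmetric]
  by (simp add: E2_field_def E2_dL_eq vec_eq_iff forall_3)

lemma E2_brackets:
  "E2_lie (axis 2 1) (axis 3 1) = axis 1 1"
  "E2_lie (axis 3 1) (axis 1 1) = axis 2 1"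
  "E2_lie (axis 1 1) (axis 2 1) = 0"
  by (simp_all add: E2_lie_eq vec_eq_iff forall_3 axis_def)

lemma bform_eq_inner: "bform A u v = (transpose A *v u) \<bullet> v"
  unfolding bform_def matrix_vector_mult_def transpose_def inner_vec_def
  by (subst sum.swap) (simp add: sum_distrib_right)

lemma RG_hat_eq:
  assumes "riemannian_metric g"
  shows "bform (g 0) (RG_hat \<alpha> g u) v = bform (RG \<alpha> g 0) u v"
proof -
  let ?A = "transpose (g 0)"
  have "w = 0" if "?A *v w = 0" for w
    using assms that unfolding riemannian_metric_def bform_eq_inner
    by (metis inner_zero_left less_irrefl)
  then have inj: "inj ((*v) ?A)"
    by (simp add: linear_injective_0 del: transpose_matrix_vector)
  then have "surj ((*v) ?A)"
    using linear_injective_imp_surjective[OF matrix_vector_mul_linear] by blast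
  then obtain w where w: "?A *v w = transpose (RG \<alpha> g 0) *v u"
    by (metis surjD)
  have "\<exists>!w. \<forall>v. bform (g 0) w v = bform (RG \<alpha> g 0) u v"
    unfolding bform_eq_inner vector_eq_rdot
  proof (rule ex1I[of _ w])
    show "?A *v w = transpose (RG \<alpha> g 0) *v u" by (rule w)
  next
    fix w' assume "?A *v w' = transpose (RG \<alpha> g 0) *v u"
    then have "?A *v w' = ?A *v w" by (rule trans[OF _ w[symmetric]])
    then show "w' = w" by (rule injD[OF inj])
  qed
  from theI'[OF this] show ?thesis unfolding RG_hat_def by blast
qed

lemma bform_mat_1: "bform (mat 1) u v = u \<bullet> v"
  by (simp add: bform_eq_inner)

lemma pderiv_at_const [simp]: "pderiv_at i (\<lambda>_. c) x = 0"
  by (simp add: pderiv_at_def)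

lemma smooth_fun_const: "smooth_fun (\<lambda>_::real^'n::finite. c)"
proof -
  have "pderiv_at i (\<lambda>_. c) = (\<lambda>_. 0)" for i :: 'n and c by (rule ext) simp
  then have "\<exists>c. f = (\<lambda>_. c) \<Longrightarrow> smooth_fun f" for f :: "real^'n \<Rightarrow> real"
    by (coinduction arbitrary: f) auto
  then show ?thesis by blast
qed

lemma E2_euclidean_metric: "E2_left_invariant_metric (\<lambda>_. mat 1)" "flat ((\<lambda>_. mat 1) :: 3 metric)"
proof -
  have rot: "(c*a - s*b) * (c*a' - s*b') + (s*a + c*b) * (s*a' + c*b') = a*a' + b*b'"
    if "s\<^sup>2 + c\<^sup>2 = 1" for a b a' b' c s :: real
  proof -
    have "(c*a - s*b) * (c*a' - s*b') + (s*a + c*b) * (s*a' + c*b')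
        = (s\<^sup>2 + c\<^sup>2) * (a*a' + b*b')" by (simp add: algebra_simps power2_eq_square)
    then show ?thesis using that by simp
  qed
  have "E2_dL a p u \<bullet> E2_dL a p v = u \<bullet> v" for a p u v
    unfolding E2_dL_eq inner_vec_def sum_3 vector_3 inner_real_def
    by (rule arg_cong[where f = "\<lambda>r. r + u$3 * v$3", OF rot[OF sin_cos_squared_add]])
  then show "E2_left_invariant_metric (\<lambda>_. mat 1)"
    unfolding E2_left_invariant_metric_def riemannian_metric_def bform_mat_1
    by (intro conjI allI impI smooth_fun_const inner_commute) (simp_all only: inner_gt_zero_iff not_False_eq_True)
  have "christoffel (\<lambda>_. mat 1 :: real^3^3) k i j = (\<lambda>_. 0)" for i j k
    by (rule ext) (simp only: christoffel_def pderiv_at_const add_0 diff_self mult_zero_right sum.neutral_const)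
  then show "flat ((\<lambda>_. mat 1) :: 3 metric)"
    by (simp only: flat_def Rm_def riemann_up_def pderiv_at_const diff_self mult_zero_left
        sum.neutral_const add_0 simp_thms)
qed

end

theory Submission
  imports Defs
begin

text \<open>Every left invariant metric on E(2) has an orthonormal Milnor frame \<open>f\<^sub>1, f\<^sub>2, f\<^sub>3\<close> with
  \<open>[f\<^sub>2,f\<^sub>3] = a f\<^sub>1\<close>, \<open>[f\<^sub>3,f\<^sub>1] = b f\<^sub>2\<close>, \<open>[f\<^sub>1,f\<^sub>2] = 0\<close> and \<open>a, b > 0\<close>: the plane spanned by
  \<open>e\<^sub>1, e\<^sub>2\<close> contains a direction orthogonal to its own rotation by a right angle.  In this frame the
  curvature operator and \<open>RG\<close> are diagonal, and the curvature vanishes if \<open>a = b\<close>.  A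
  derivation of the Lie algebra has image in the plane of \<open>e\<^sub>1, e\<^sub>2\<close> and acts on this plane as a
  complex number.  So on a steady soliton the eigenvalues of \<open>RG\<close> satisfy \<open>\<rho>\<^sub>3 = 0\<close> and
  \<open>\<rho>\<^sub>1 = \<rho>\<^sub>2\<close>.  If \<open>a \<noteq> b\<close>, the second equation gives \<open>\<alpha> (a - b)\<^sup>2 = 4\<close> and then the first one
  \<open>6 a\<^sup>2 + 20 a b + 6 b\<^sup>2 = 0\<close>, which is absurd.\<close>

section \<open>Calculus and linear algebra in coordinates\<close>

lemma pderiv_at_comp_coordinate:
  fixes x :: "real^'n::finite"
  assumes "(f has_real_derivative D) (at (x $ k))"
  shows "pderiv_at i (\<lambda>y. f (y $ k)) x = axis i 1 $ k * D"
proof -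
  have "((\<lambda>y::real^'n. y $ k) has_derivative (\<lambda>y. y $ k)) (at x)"
    by (rule bounded_linear_imp_has_derivative[OF bounded_linear_vec_nth])
  moreover have "(f has_derivative (*) D) (at (x $ k))"
    using assms by (simp add: has_field_derivative_def)
  ultimately have "((\<lambda>y. f (y $ k)) has_derivative (\<lambda>h. D * h $ k)) (at x)"
    by (rule has_derivative_compose)
  from frechet_derivative_at[OF this, symmetric] show ?thesis
    by (simp add: pderiv_at_def)
qed

lemma linear_vec_sum_axis:
  fixes f :: "real^'n::finite \<Rightarrow> 'b::real_vector"
  assumes "linear f"
  shows "(\<Sum>i\<in>UNIV. (x $ i) *\<^sub>R f (axis i 1)) = f x"
proof -
  have "f x = f (\<Sum>i\<in>UNIV. (x $ i) *\<^sub>R axis i 1)"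
    using basis_expansion[of x] by (simp add: scalar_mult_eq_scaleR)
  also have "\<dots> = (\<Sum>i\<in>UNIV. (x $ i) *\<^sub>R f (axis i 1))"
    using assms by (simp add: linear_sum linear_cmul)
  finally show ?thesis by simp
qed

lemma matrix_inv_eqI:
  fixes A B :: "real^'n::finite^'n"
  assumes "A ** B = mat 1"
  shows "matrix_inv A = B"
proof -
  have BA: "B ** A = mat 1" using assms matrix_left_right_inverse by blast
  then have "invertible A" using assms unfolding invertible_def by blast
  then have "A ** matrix_inv A = mat 1" unfolding invertible_def matrix_inv_def by (rule someI2_ex) simp
  then show ?thesis using BA by (metis matrix_mul_assoc matrix_mul_lid matrix_mul_rid)
qed

section \<open>The left invariant metric given by a Milnor frame\<close>

locale milnor_frame =
  fixes m n z u v \<phi> :: real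
  assumes m: "m > 0" and n: "n > 0" and z: "z > 0"
begin

text \<open>The columns of \<open>frame t\<close> are the values, at the points with third coordinate \<open>t\<close>, of the left
  invariant fields of the Milnor frame: the first two are \<open>1/m\<close> and \<open>1/n\<close> times the unit vectors
  of the plane at angles \<open>\<phi> + t\<close> and \<open>\<phi> + t + \<pi>/2\<close>.\<close>

definition coframe :: "real \<Rightarrow> real^3^3" where
  "coframe t = vector
     [vector [m * cos (\<phi> + t), m * sin (\<phi> + t), - (m * u / z)],
      vector [- (n * sin (\<phi> + t)), n * cos (\<phi> + t), - (n * v / z)],
      vector [0, 0, 1 / z]]"

definition frame :: "real \<Rightarrow> real^3^3" where
  "frame t = vector
     [vector [cos (\<phi> + t) / m, - (sin (\<phi> + t) / n), u * cos (\<phi> + t) - v * sin (\<phi> + t)],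
      vector [sin (\<phi> + t) / m, cos (\<phi> + t) / n, u * sin (\<phi> + t) + v * cos (\<phi> + t)],
      vector [0, 0, z]]"

definition metric :: "real^3 \<Rightarrow> real^3^3" where
  "metric x = transpose (coframe (x $ 3)) ** coframe (x $ 3)"

text \<open>\<open>a\<close> and \<open>b\<close> are the structure constants of the frame. The
  third frame vector has a horizontal part, given by \<open>u\<close> and \<open>v\<close>, which
  \<open>z J\<close> maps to \<open>- p\<close> times the first plus \<open>q\<close> times the
  second frame vector.\<close>

definition a where "a = z * m / n"
definition b where "b = z * n / m"
definition p where "p = z * v * m"
definition q where "q = z * u * n"

text \<open>The tensors below are constant in frame components.  With \<open>J\<close> the generator of the rotations
  of the plane, \<open>ad3\<close> is \<open>z J\<close>, the flat derivative of the frame in direction of its third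
  field, and \<open>T\<close> is the Christoffel tensor \<open>\<nabla>\<^sub>w w' - w\<^sub>3 z J w'\<close>.\<close>

definition ad3 :: "real^3 \<Rightarrow> real^3" where
  "ad3 w = vector [- (a * w$2) - p * w$3, b * w$1 + q * w$3, 0]"

definition T :: "real^3 \<Rightarrow> real^3 \<Rightarrow> real^3" where
  "T w w' = vector
     [(a - b) / 2 * (w$2 * w'$3 + w$3 * w'$2) + p * w$3 * w'$3,
      (a - b) / 2 * (w$1 * w'$3 + w$3 * w'$1) - q * w$3 * w'$3,
      - ((a - b) / 2 * (w$1 * w'$2 + w$2 * w'$1))]"

text \<open>Sectional curvatures; \<open>K $ i\<close> is that of the plane orthogonal to the \<open>i\<close>-th frame vector.\<close>

definition K :: "real^3" where
  "K = vector [- ((a - b) * (3 * a + b) / 4), (a - b) * (a + 3 * b) / 4, (a - b)\<^sup>2 / 4]"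

text \<open>The cross product identifies bivectors with vectors, and \<open>K\<close> is the
  diagonal of the curvature operator. The sign is such that \<open>curv w w' w' \<bullet> w\<close>
  is the sum of \<open>K $ i\<close> times the squared components of
  \<open>cross3 w w'\<close>.\<close>

definition curv :: "real^3 \<Rightarrow> real^3 \<Rightarrow> real^3 \<Rightarrow> real^3" where
  "curv w w' w'' = cross3 w'' (\<chi> i. K $ i * cross3 w w' $ i)"

text \<open>The frame components of the \<open>i\<close>-th coordinate field.\<close>

abbreviation cf :: "real \<Rightarrow> 3 \<Rightarrow> real^3" where
  "cf t i \<equiv> coframe t *v axis i 1"

lemma coframe_mult_frame: "coframe t ** frame t = mat 1"
proof -
  define c s where "c = cos (\<phi> + t)" and "s = sin (\<phi> + t)"
  have *: "c * c + s * s = 1"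
    unfolding c_def s_def using sin_cos_squared_add2[of "\<phi> + t"] by (simp add: power2_eq_square)
  show ?thesis using m n z
    by (simp add: coframe_def frame_def matrix_matrix_mult_def mat_def vec_eq_iff forall_3 sum_3
          field_simps flip: c_def s_def)
       (use * in \<open>intro conjI; algebra\<close>)
qed

lemma frame_mult_coframe: "frame t ** coframe t = mat 1"
  using coframe_mult_frame matrix_left_right_inverse by blast

lemma coframe_frame [simp]: "coframe t *v (frame t *v w) = w"
  by (simp add: matrix_vector_mul_assoc coframe_mult_frame)

lemma frame_coframe [simp]: "frame t *v (coframe t *v w) = w"
  by (simp add: matrix_vector_mul_assoc frame_mult_coframe)

text \<open>All coefficients depend on the third coordinate only. This turns the chain rule factor
  into a frame component; its \<open>z\<close> cancels the \<open>1 / z\<close> of the derivatives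
  below.\<close>

lemma axis_3_eq: "axis i 1 $ 3 = z * cf t i $ 3"
  using z by (simp add: coframe_def matrix_vector_mult_def sum_3)

text \<open>Moving \<open>t\<close> rotates the frame, so its derivative is \<open>J\<close> applied
  to it, which is \<open>ad3\<close> divided by \<open>z\<close> in frame components. The inverse
  matrix gets the opposite sign.\<close>

lemma coframe_deriv:
  "((\<lambda>s. (coframe s *v w) $ k) has_real_derivative - (ad3 (coframe t *v w) $ k / z)) (at t)"
proof -
  have "\<forall>k. ((\<lambda>s. (coframe s *v w) $ k) has_real_derivative - (ad3 (coframe t *v w) $ k / z)) (at t)"
    unfolding forall_3
    using m n z
    by (auto simp: coframe_def ad3_def matrix_vector_mult_def sum_3 a_def b_def p_def q_def
       divide_simps intro!: derivative_eq_intros) (simp_all add: algebra_simps)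
  then show ?thesis by blast
qed

lemma frame_deriv:
  "((\<lambda>s. (frame s *v w) $ k) has_real_derivative ((frame t *v ad3 w) $ k / z)) (at t)"
proof -
  have "\<forall>k. ((\<lambda>s. (frame s *v w) $ k) has_real_derivative ((frame t *v ad3 w) $ k / z)) (at t)"
    unfolding forall_3
    using m n z
    by (auto simp: frame_def ad3_def matrix_vector_mult_def sum_3 a_def b_def p_def q_def
       divide_simps intro!: derivative_eq_intros) (simp_all add: algebra_simps)
  then show ?thesis by blast
qed

lemma metric_nth: "metric x $ i $ j = cf (x$3) i \<bullet> cf (x$3) j"
  by (simp add: metric_def matrix_matrix_mult_def transpose_def inner_vec_def
      matrix_vector_mult_basis column_def)

lemma ginv_metric: "matrix_inv (metric x) = frame (x$3) ** transpose (frame (x$3))"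
proof (rule matrix_inv_eqI)
  have "transpose (coframe t) ** transpose (frame t) = mat 1" for t
    by (simp add: frame_mult_coframe flip: matrix_transpose_mul)
  then show "metric x ** (frame (x$3) ** transpose (frame (x$3))) = mat 1"
    unfolding metric_def
    by (metis coframe_mult_frame matrix_mul_assoc matrix_mul_lid)
qed

text \<open>Raising an index: with \<open>F = frame (x$3)\<close>, the inverse metric is
  \<open>F ** transpose F\<close>, and its second factor cancels the transposed coframe.\<close>

lemma ginv_contract:
  "(\<Sum>l\<in>UNIV. ginv metric x k l * (w \<bullet> cf (x$3) l)) = (frame (x$3) *v w) $ k"
proof -
  let ?A = "coframe (x$3)" and ?F = "frame (x$3)"
  have "w \<bullet> cf (x$3) l = (transpose ?A *v w) $ l" for l
    by (metis cart_eq_inner_axis dot_lmul_matrix transpose_matrix_vector)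
  then have "(\<Sum>l\<in>UNIV. ginv metric x k l * (w \<bullet> cf (x$3) l))
      = (matrix_inv (metric x) *v (transpose ?A *v w)) $ k"
    unfolding ginv_def by (simp only: matrix_vector_mult_def[of "matrix_inv _"] vec_lambda_beta)
  also have "\<dots> = (?F *v w) $ k"
    unfolding ginv_metric matrix_vector_mul_assoc
    by (metis coframe_mult_frame matrix_mul_assoc matrix_mul_rid matrix_transpose_mul transpose_mat)
  finally show ?thesis .
qed

text \<open>The parenthesised terms are the derivatives of the metric, so \<open>T\<close> gives the Christoffel symbols.\<close>

lemma koszul:
  "w$3 * (- (ad3 w' \<bullet> w'') - w' \<bullet> ad3 w'') + w'$3 * (- (ad3 w \<bullet> w'') - w \<bullet> ad3 w'')
     - w''$3 * (- (ad3 w \<bullet> w') - w \<bullet> ad3 w') = 2 * (T w w' \<bullet> w'')"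
  by (simp add: ad3_def T_def inner_vec_def sum_3 field_simps)

text \<open>The left side is the coordinate formula of the curvature in frame components: two
  derivatives of Christoffel symbols, then the quadratic terms. The parameters \<open>p\<close> and
  \<open>q\<close> cancel.\<close>

lemma curvature_identity:
  "w$3 *\<^sub>R (ad3 (T w' w'') - T (ad3 w') w'' - T w' (ad3 w''))
   - w'$3 *\<^sub>R (ad3 (T w w'') - T (ad3 w) w'' - T w (ad3 w''))
   + T w (T w' w'') - T w' (T w w'') = curv w w' w''"
  by (simp add: vec_eq_iff forall_3 ad3_def T_def curv_def K_def cross3_def field_simps power2_eq_square)

lemma linear_T: "linear (T w)"
  by (rule linearI) (simp_all add: T_def vec_eq_iff forall_3 field_simps)


section \<open>Christoffel symbols and curvature in the chart\<close>

lemma pderiv_metric: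
  "pderiv_at k (\<lambda>y. metric y $ i $ j) x
     = cf (x$3) k $ 3 * (- (ad3 (cf (x$3) i) \<bullet> cf (x$3) j) - cf (x$3) i \<bullet> ad3 (cf (x$3) j))"
proof -
  have "((\<lambda>t. cf t i \<bullet> cf t j) has_real_derivative
      (- (ad3 (cf (x$3) i) \<bullet> cf (x$3) j) - cf (x$3) i \<bullet> ad3 (cf (x$3) j)) / z) (at (x $ 3))"
    unfolding inner_vec_def inner_real_def sum_3
    by (rule derivative_eq_intros coframe_deriv refl)+ (use z in \<open>simp add: field_simps\<close>)
  from pderiv_at_comp_coordinate[OF this] show ?thesis
    using z by (simp add: metric_nth axis_3_eq[of _ "x $ 3"])
qed

lemma christoffel_metric:
  "christoffel metric k i j = (\<lambda>x. (frame (x$3) *v T (cf (x$3) i) (cf (x$3) j)) $ k)"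
proof
  fix x
  have "(1/2) * (\<Sum>l\<in>UNIV. ginv metric x k l *
     (pderiv_at i (\<lambda>y. metric y $ j $ l) x + pderiv_at j (\<lambda>y. metric y $ i $ l) x
       - pderiv_at l (\<lambda>y. metric y $ i $ j) x))
     = (1/2) * (\<Sum>l\<in>UNIV. ginv metric x k l * (2 * (T (cf (x$3) i) (cf (x$3) j) \<bullet> cf (x$3) l)))"
    unfolding pderiv_metric koszul ..
  also have "\<dots> = (\<Sum>l\<in>UNIV. ginv metric x k l * (T (cf (x$3) i) (cf (x$3) j) \<bullet> cf (x$3) l))"
    by (simp add: sum_distrib_left)
  finally show "christoffel metric k i j x = (frame (x$3) *v T (cf (x$3) i) (cf (x$3) j)) $ k"
    unfolding christoffel_def ginv_contract .
qed

text \<open>Makes the product rule for real functions applicable when both the frame and the vector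
  \<open>w\<close> vary with \<open>t\<close>.\<close>

lemma frame_component_expand:
  "(frame t *v w) $ k = (\<Sum>i\<in>UNIV. w $ i * (frame t *v axis i 1) $ k)"
  using arg_cong[OF linear_vec_sum_axis[OF matrix_vector_mul_linear[of "frame t"], of w],
      of "\<lambda>y. y $ k"] by simp

lemma linear_ad3: "linear ad3"
  by (rule linearI) (simp_all add: ad3_def vec_eq_iff forall_3 field_simps)

lemma T_coframe_deriv:
  "((\<lambda>s. T (coframe s *v w) (coframe s *v w') $ i) has_real_derivative
      - ((T (ad3 (coframe t *v w)) (coframe t *v w')
         + T (coframe t *v w) (ad3 (coframe t *v w'))) $ i / z)) (at t)"
proof -
  have "\<forall>i. ((\<lambda>s. T (coframe s *v w) (coframe s *v w') $ i) has_real_derivative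
      - ((T (ad3 (coframe t *v w)) (coframe t *v w')
         + T (coframe t *v w) (ad3 (coframe t *v w'))) $ i / z)) (at t)"
    unfolding forall_3 T_def vector_3 vector_add_component
    by (intro conjI; (rule derivative_eq_intros coframe_deriv refl)+;
        use z in \<open>simp add: field_simps\<close>)
  then show ?thesis by blast
qed

text \<open>Product rule: the frame contributes \<open>ad3\<close> in front of \<open>T\<close>, and
  each of the two coframe arguments contributes \<open>- ad3\<close>.\<close>

lemma pderiv_christoffel:
  "pderiv_at l (christoffel metric k i j) x = cf (x$3) l $ 3 * (frame (x$3) *v
     (ad3 (T (cf (x$3) i) (cf (x$3) j)) - T (ad3 (cf (x$3) i)) (cf (x$3) j)
        - T (cf (x$3) i) (ad3 (cf (x$3) j)))) $ k"
    (is "_ = _ * (_ *v ?W) $ _")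
proof -
  let ?t = "x $ 3" and ?w = "\<lambda>t. T (cf t i) (cf t j)"
  let ?w' = "T (ad3 (cf (x$3) i)) (cf (x$3) j) + T (cf (x$3) i) (ad3 (cf (x$3) j))"
  have "((\<lambda>s. \<Sum>a\<in>UNIV. ?w s $ a * (frame s *v axis a 1) $ k) has_real_derivative
     (\<Sum>a\<in>UNIV. - (?w' $ a / z) * (frame ?t *v axis a 1) $ k
        + (frame ?t *v ad3 (axis a 1)) $ k / z * ?w ?t $ a)) (at ?t)"
    by (rule DERIV_sum DERIV_mult T_coframe_deriv frame_deriv)+
  also have "(\<Sum>a\<in>UNIV. - (?w' $ a / z) * (frame ?t *v axis a 1) $ k
        + (frame ?t *v ad3 (axis a 1)) $ k / z * ?w ?t $ a)
     = ((\<Sum>a\<in>UNIV. ?w ?t $ a *\<^sub>R (frame ?t *v ad3 (axis a 1))) $ k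
         - (\<Sum>a\<in>UNIV. ?w' $ a *\<^sub>R (frame ?t *v axis a 1)) $ k) / z"
    by (simp add: sum.distrib sum_negf sum_divide_distrib diff_divide_distrib mult.commute
         flip: sum_subtractf)
  also have "\<dots> = (frame ?t *v ?W) $ k / z"
    using linear_vec_sum_axis[OF linear_compose[OF linear_ad3 matrix_vector_mul_linear[of "frame ?t"]], of "?w ?t"]
      linear_vec_sum_axis[OF matrix_vector_mul_linear[of "frame ?t"], of ?w']
    by (simp add: o_def matrix_vector_mult_diff_distrib matrix_vector_right_distrib algebra_simps)
  finally have "((\<lambda>s. (frame s *v ?w s) $ k) has_real_derivative (frame ?t *v ?W) $ k / z) (at ?t)"
    by (simp flip: frame_component_expand)
  from pderiv_at_comp_coordinate[OF this] show ?thesis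
    using z by (simp add: christoffel_metric axis_3_eq[of _ "x $ 3"])
qed

text \<open>The sum over \<open>h\<close> expands the inner vector in the coordinate basis, so by
  linearity it composes the two Christoffel operators.\<close>

lemma christoffel_product:
  "(\<Sum>h\<in>UNIV. christoffel metric h j k x * christoffel metric l i h x)
     = (frame (x$3) *v T (cf (x$3) i) (T (cf (x$3) j) (cf (x$3) k))) $ l"
proof -
  let ?t = "x $ 3"
  let ?f = "\<lambda>y. frame ?t *v T (cf ?t i) (coframe ?t *v y)"
  have "linear ?f"
    using linear_compose[OF linear_compose[OF matrix_vector_mul_linear linear_T] matrix_vector_mul_linear]
    by (simp add: o_def)
  from arg_cong[OF linear_vec_sum_axis[OF this, of "frame ?t *v T (cf ?t j) (cf ?t k)"], of "\<lambda>y. y $ l"]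
  show ?thesis by (simp add: christoffel_metric)
qed

lemma riemann_up_metric:
  "riemann_up metric i j k l x
     = (frame (x$3) *v curv (cf (x$3) i) (cf (x$3) j) (cf (x$3) k)) $ l"
  unfolding riemann_up_def pderiv_christoffel sum_subtractf christoffel_product
    curvature_identity[symmetric]
  by (simp add: matrix_vector_mult_diff_distrib matrix_vector_right_distrib
      matrix_vector_mult_scaleR algebra_simps)

section \<open>Contractions: \<open>Rm\<close>, the Ricci tensor and \<open>Rm2\<close>\<close>

lemma vec_sum_cf:
  assumes "linear f"
  shows "(\<Sum>i\<in>UNIV. (y $ i) *\<^sub>R f (cf t i)) = f (coframe t *v y)"
  using linear_vec_sum_axis[OF linear_compose[OF matrix_vector_mul_linear assms]] by (simp add: o_def)

lemma Rm_metric: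
  "Rm metric x i j k l = curv (cf (x$3) i) (cf (x$3) j) (cf (x$3) k) \<bullet> cf (x$3) l"
proof -
  have "linear (\<lambda>y. y \<bullet> cf (x$3) l)"
    by (rule linearI) (simp_all add: inner_add_left)
  from vec_sum_cf[OF this] show ?thesis
    by (simp add: Rm_def riemann_up_metric metric_nth)
qed

lemma linear_curv:
  "linear (\<lambda>w. curv w w' w'')" "linear (\<lambda>w'. curv w w' w'')" "linear (curv w w')"
  by (rule linearI; simp add: curv_def cross3_def vec_eq_iff forall_3 field_simps)+

text \<open>The frame is orthonormal, so contracting with the inverse metric is summing over the
  frame. General values in \<open>'b\<close> allow the three contractions of \<open>Rm2\<close> to
  be done one after the other, with values in \<open>real\<close>, \<open>real^3\<close> and
  \<open>real^3^3\<close>.\<close>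

lemma ginv_bilinear_contract:
  fixes f h :: "real^3 \<Rightarrow> 'b::real_inner"
  assumes f: "linear f" and h: "linear h"
  shows "(\<Sum>k\<in>UNIV. \<Sum>l\<in>UNIV. ginv metric x k l * (f (cf (x$3) k) \<bullet> h (cf (x$3) l)))
    = (\<Sum>i\<in>UNIV. f (axis i 1) \<bullet> h (axis i 1))"
proof -
  let ?F = "frame (x$3)" and ?C = "cf (x$3)"
  have *: "(\<Sum>l\<in>UNIV. ginv metric x k l *\<^sub>R h (?C l)) = (\<Sum>i\<in>UNIV. (?F *v axis i 1) $ k *\<^sub>R h (axis i 1))"
    for k
  proof -
    have "(\<Sum>l\<in>UNIV. ginv metric x k l *\<^sub>R ?C l) $ i = (?F *v axis i 1) $ k" for i
      using ginv_contract[of x k "axis i 1"] by (simp add: inner_axis')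
    then have "(\<Sum>i\<in>UNIV. (?F *v axis i 1) $ k *\<^sub>R h (axis i 1))
        = h (\<Sum>l\<in>UNIV. ginv metric x k l *\<^sub>R ?C l)"
      using linear_vec_sum_axis[OF h, of "\<Sum>l\<in>UNIV. ginv metric x k l *\<^sub>R ?C l"] by simp
    then show ?thesis by (simp add: linear_sum[OF h] linear_cmul[OF h])
  qed
  have "(\<Sum>k\<in>UNIV. \<Sum>l\<in>UNIV. ginv metric x k l * (f (?C k) \<bullet> h (?C l)))
      = (\<Sum>k\<in>UNIV. f (?C k) \<bullet> (\<Sum>l\<in>UNIV. ginv metric x k l *\<^sub>R h (?C l)))"
    by (simp add: inner_sum_right)
  also have "\<dots> = (\<Sum>i\<in>UNIV. (\<Sum>k\<in>UNIV. (?F *v axis i 1) $ k *\<^sub>R f (?C k)) \<bullet> h (axis i 1))"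
    unfolding * by (simp add: inner_sum_right inner_sum_left) (rule sum.swap)
  also have "\<dots> = (\<Sum>i\<in>UNIV. f (axis i 1) \<bullet> h (axis i 1))"
    by (simp add: vec_sum_cf[OF f])
  finally show ?thesis .
qed

lemma frame_trace:
  assumes f: "linear f"
  shows "(\<Sum>i\<in>UNIV. (frame t *v f (cf t i)) $ i) = (\<Sum>i\<in>UNIV. f (axis i 1) $ i)"
proof -
  have "(\<Sum>i\<in>UNIV. (frame t *v f (cf t i)) $ i)
      = (\<Sum>i\<in>UNIV. \<Sum>j\<in>UNIV. f (cf t i) $ j * (frame t *v axis j 1) $ i)"
    by (subst frame_component_expand) (rule refl)
  also have "\<dots> = (\<Sum>j\<in>UNIV. (\<Sum>i\<in>UNIV. (frame t *v axis j 1) $ i *\<^sub>R f (cf t i)) $ j)"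
    by (subst sum.swap) (simp add: mult.commute)
  also have "\<dots> = (\<Sum>i\<in>UNIV. f (axis i 1) $ i)"
    by (simp add: vec_sum_cf[OF f])
  finally show ?thesis .
qed

lemma Rc_metric:
  "Rc metric x $ j $ k = (\<Sum>i\<in>UNIV. curv (axis i 1) (cf (x$3) j) (cf (x$3) k) $ i)"
  by (simp add: Rc_def riemann_up_metric frame_trace[OF linear_curv(1)])

lemma Rm2_metric:
  "Rm2 metric x $ i $ j = (\<Sum>k\<in>UNIV. \<Sum>l\<in>UNIV.
     curv (cf (x$3) i) (axis k 1) (axis l 1) \<bullet> curv (cf (x$3) j) (axis k 1) (axis l 1))"
proof -
  let ?C = "cf (x$3)" and ?G = "ginv metric x"
  let ?R = "\<lambda>i k l. curv (?C i) (?C k) (?C l)"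
  \<comment> \<open>Each index is moved next to the one it is contracted with.\<close>
  have reorder: "(\<Sum>k\<in>UNIV. \<Sum>l\<in>UNIV. \<Sum>m\<in>UNIV. \<Sum>p\<in>UNIV. \<Sum>q\<in>UNIV. \<Sum>r\<in>UNIV. X k l m p q r)
      = (\<Sum>k\<in>UNIV. \<Sum>p\<in>UNIV. \<Sum>l\<in>UNIV. \<Sum>q\<in>UNIV. \<Sum>m\<in>UNIV. \<Sum>r\<in>UNIV. X k l m p q r)"
    for X :: "3 \<Rightarrow> 3 \<Rightarrow> 3 \<Rightarrow> 3 \<Rightarrow> 3 \<Rightarrow> 3 \<Rightarrow> real"
  proof (rule sum.cong[OF refl])
    fix k
    have "(\<Sum>l\<in>UNIV. \<Sum>m\<in>UNIV. \<Sum>p\<in>UNIV. \<Sum>q\<in>UNIV. \<Sum>r\<in>UNIV. X k l m p q r)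
        = (\<Sum>l\<in>UNIV. \<Sum>p\<in>UNIV. \<Sum>m\<in>UNIV. \<Sum>q\<in>UNIV. \<Sum>r\<in>UNIV. X k l m p q r)"
      by (rule sum.cong[OF refl]) (rule sum.swap)
    also have "\<dots> = (\<Sum>p\<in>UNIV. \<Sum>l\<in>UNIV. \<Sum>m\<in>UNIV. \<Sum>q\<in>UNIV. \<Sum>r\<in>UNIV. X k l m p q r)"
      by (rule sum.swap)
    also have "\<dots> = (\<Sum>p\<in>UNIV. \<Sum>l\<in>UNIV. \<Sum>q\<in>UNIV. \<Sum>m\<in>UNIV. \<Sum>r\<in>UNIV. X k l m p q r)"
      by (rule sum.cong[OF refl], rule sum.cong[OF refl]) (rule sum.swap)
    finally show "(\<Sum>l\<in>UNIV. \<Sum>m\<in>UNIV. \<Sum>p\<in>UNIV. \<Sum>q\<in>UNIV. \<Sum>r\<in>UNIV. X k l m p q r) = \<dots>" .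
  qed
  have lin_id: "linear (\<lambda>y::real^3. c \<bullet> y)" for c
    by (rule linearI) (simp_all add: inner_add_right)
  have c3: "(\<Sum>m\<in>UNIV. \<Sum>r\<in>UNIV. ?G m r * ((c \<bullet> ?C m) * (d \<bullet> ?C r))) = c \<bullet> d" for c d
    using ginv_bilinear_contract[OF lin_id[of c] lin_id[of d], of x]
    by (simp add: inner_axis) (simp add: inner_vec_def)
  \<comment> \<open>The remaining sum over \<open>l\<close> is packed into an inner product of
    matrices, so that the outermost contraction again has the form of
    \<open>ginv_bilinear_contract\<close>.\<close>
  have c2: "(\<Sum>l\<in>UNIV. \<Sum>q\<in>UNIV. ?G l q * (curv (?C i) w (?C l) \<bullet> curv (?C j) w' (?C q)))
      = (\<chi> l. curv (?C i) w (axis l 1)) \<bullet> (\<chi> l. curv (?C j) w' (axis l 1))" for w w'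
    using ginv_bilinear_contract[OF linear_curv(3) linear_curv(3)] by (simp add: inner_vec_def[where 'b=3])
  have lin1: "linear (\<lambda>w. \<chi> l. curv (?C i) w (axis l 1))" for i
    by (rule linearI) (simp_all add: vec_eq_iff[where 'b=3] linear_add[OF linear_curv(2)] linear_cmul[OF linear_curv(2)])
  have "Rm2 metric x $ i $ j = (\<Sum>k\<in>UNIV. \<Sum>p\<in>UNIV. \<Sum>l\<in>UNIV. \<Sum>q\<in>UNIV. \<Sum>m\<in>UNIV. \<Sum>r\<in>UNIV.
     (?R i k l \<bullet> ?C m) * (?R j p q \<bullet> ?C r) * ?G k p * ?G l q * ?G m r)"
    unfolding Rm2_def Rm_metric vec_lambda_beta by (rule reorder)
  also have "\<dots> = (\<Sum>k\<in>UNIV. \<Sum>p\<in>UNIV. ?G k p * (\<Sum>l\<in>UNIV. \<Sum>q\<in>UNIV. ?G l q *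
     (\<Sum>m\<in>UNIV. \<Sum>r\<in>UNIV. ?G m r * ((?R i k l \<bullet> ?C m) * (?R j p q \<bullet> ?C r)))))"
    unfolding sum_distrib_left by (intro sum.cong refl) (simp add: ac_simps)
  also have "\<dots> = (\<Sum>k\<in>UNIV. (\<chi> l. curv (?C i) (axis k 1) (axis l 1)) \<bullet> (\<chi> l. curv (?C j) (axis k 1) (axis l 1)))"
    unfolding c3 c2 by (rule ginv_bilinear_contract[OF lin1 lin1])
  finally show ?thesis by (simp add: inner_vec_def[where 'b=3])
qed

section \<open>Eigenvalues of \<open>RG\<close> in the Milnor frame\<close>

definition \<rho> :: "real \<Rightarrow> real^3" where
  "\<rho> \<alpha> = - vector [2 * (K$2 + K$3) + \<alpha> * ((K$2)\<^sup>2 + (K$3)\<^sup>2),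
                2 * (K$1 + K$3) + \<alpha> * ((K$1)\<^sup>2 + (K$3)\<^sup>2),
                2 * (K$1 + K$2) + \<alpha> * ((K$1)\<^sup>2 + (K$2)\<^sup>2)]"

lemma curv_trace:
  "(\<Sum>i\<in>UNIV. curv (axis i 1) w w' $ i)
     = (K$2 + K$3) * (w$1 * w'$1) + (K$1 + K$3) * (w$2 * w'$2) + (K$1 + K$2) * (w$3 * w'$3)"
  by (simp add: sum_3 curv_def cross3_def axis_def algebra_simps)

text \<open>The curvature endomorphism of a coordinate plane is a multiple of the infinitesimal
  rotation in that plane, so it moves two frame vectors by the same length. Hence the factor
  2.\<close>

lemma curv_square:
  "(\<Sum>k\<in>UNIV. \<Sum>l\<in>UNIV. curv w (axis k 1) (axis l 1) \<bullet> curv w' (axis k 1) (axis l 1))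
     = 2 * (((K$2)\<^sup>2 + (K$3)\<^sup>2) * (w$1 * w'$1) + ((K$1)\<^sup>2 + (K$3)\<^sup>2) * (w$2 * w'$2)
         + ((K$1)\<^sup>2 + (K$2)\<^sup>2) * (w$3 * w'$3))"
  by (simp add: sum_3 curv_def cross3_def axis_def inner_vec_def algebra_simps power2_eq_square)

lemma RG_metric_nth:
  "RG \<alpha> metric x $ i $ j = (\<Sum>k\<in>UNIV. \<rho> \<alpha> $ k * (cf (x$3) i $ k * cf (x$3) j $ k))"
  by (simp add: RG_def Rc_metric Rm2_metric curv_trace curv_square) (simp add: \<rho>_def sum_3 algebra_simps)

lemma bform_RG_metric:
  "bform (RG \<alpha> metric x) (frame (x$3) *v w) (frame (x$3) *v w') = (\<Sum>k\<in>UNIV. \<rho> \<alpha> $ k * (w $ k * w' $ k))"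
proof -
  have *: "(\<Sum>i\<in>UNIV. cf (x$3) i $ k * (frame (x$3) *v w) $ i) = w $ k" for w k
    using arg_cong[OF vec_sum_cf[OF linear_id, of "frame (x$3) *v w" "x$3"], of "\<lambda>y. y $ k"]
    by (simp add: mult.commute)
  have "bform (RG \<alpha> metric x) y y' = (\<Sum>k\<in>UNIV. \<rho> \<alpha> $ k * ((\<Sum>i\<in>UNIV. cf (x$3) i $ k * y $ i)
      * (\<Sum>i\<in>UNIV. cf (x$3) i $ k * y' $ i)))" for y y'
  proof -
    have "bform (RG \<alpha> metric x) y y' = (\<Sum>i\<in>UNIV. \<Sum>j\<in>UNIV. \<Sum>k\<in>UNIV.
        \<rho> \<alpha> $ k * (cf (x$3) i $ k * y $ i * (cf (x$3) j $ k * y' $ j)))"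
      by (simp add: bform_def RG_metric_nth sum_distrib_left sum_distrib_right ac_simps)
    also have "\<dots> = (\<Sum>i\<in>UNIV. \<Sum>k\<in>UNIV. \<Sum>j\<in>UNIV.
        \<rho> \<alpha> $ k * (cf (x$3) i $ k * y $ i * (cf (x$3) j $ k * y' $ j)))"
      by (rule sum.cong[OF refl]) (rule sum.swap)
    also have "\<dots> = (\<Sum>k\<in>UNIV. \<Sum>i\<in>UNIV. \<Sum>j\<in>UNIV.
        \<rho> \<alpha> $ k * (cf (x$3) i $ k * y $ i * (cf (x$3) j $ k * y' $ j)))"
      by (rule sum.swap)
    also have "\<dots> = (\<Sum>k\<in>UNIV. \<rho> \<alpha> $ k * (\<Sum>i\<in>UNIV. \<Sum>j\<in>UNIV.
        cf (x$3) i $ k * y $ i * (cf (x$3) j $ k * y' $ j)))"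
      by (simp only: sum_distrib_left)
    finally show ?thesis by (simp only: sum_product)
  qed
  then show ?thesis by (simp only: *)
qed

lemma flat_metric:
  assumes "a = b"
  shows "flat metric"
proof -
  have "curv w w' w'' = 0" for w w' w''
    using assms by (simp add: curv_def K_def cross3_def vec_eq_iff forall_3)
  then show ?thesis by (simp add: flat_def Rm_metric)
qed

lemma ab_pos: "a > 0" "b > 0"
  using m n z by (simp_all add: a_def b_def)

lemma eq_if_\<rho>:
  assumes "\<alpha> > 0" and 3: "\<rho> \<alpha> $ 3 = 0" and 12: "\<rho> \<alpha> $ 1 = \<rho> \<alpha> $ 2"
  shows "a = b"
proof (rule ccontr)
  assume "a \<noteq> b"
  then have ne: "a - b \<noteq> 0" by simp
  have "(K$2 - K$1) * (2 + \<alpha> * (K$1 + K$2)) = 0"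
    using 12 by (simp add: \<rho>_def algebra_simps power2_eq_square)
  moreover have "K$2 - K$1 = (a - b) * (a + b)" "2 + \<alpha> * (K$1 + K$2) = (4 - \<alpha> * (a - b)\<^sup>2) / 2"
    by (simp_all add: K_def field_simps power2_eq_square)
  ultimately have "(a - b) * (a + b) * (4 - \<alpha> * (a - b)\<^sup>2) = 0"
    by simp
  then have *: "\<alpha> * (a - b)\<^sup>2 = 4"
    using ne ab_pos by simp
  \<comment> \<open>Here \<open>K$1 + K$2\<close> is \<open>- (a - b)\<^sup>2 / 2\<close>, and the
    sum of the squares of \<open>K$1\<close> and \<open>K$2\<close> also has the factor
    \<open>(a - b)\<^sup>2\<close>.\<close>
  have "(a - b)\<^sup>2 * (\<alpha> * (10 * a\<^sup>2 + 12 * (a * b) + 10 * b\<^sup>2) - 16) = - 16 * \<rho> \<alpha> $ 3"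
    by (simp add: \<rho>_def K_def field_simps power2_eq_square)
  then have "(a - b)\<^sup>2 * (\<alpha> * (10 * a\<^sup>2 + 12 * (a * b) + 10 * b\<^sup>2) - 16) = 0"
    by (simp add: 3)
  then have "\<alpha> * (10 * a\<^sup>2 + 12 * (a * b) + 10 * b\<^sup>2) = 16"
    using ne by simp
  \<comment> \<open>Subtract four times the equation \<open>*\<close>.\<close>
  with * have "\<alpha> * (6 * a\<^sup>2 + 20 * (a * b) + 6 * b\<^sup>2) = 0"
    by (simp add: power2_diff algebra_simps)
  moreover have "6 * a\<^sup>2 + 20 * (a * b) + 6 * b\<^sup>2 > 0"
    using ab_pos by (simp add: add_pos_pos)
  ultimately show False using \<open>\<alpha> > 0\<close> by simp
qed

lemma bform_metric: "bform (metric x) w w' = (coframe (x$3) *v w) \<bullet> (coframe (x$3) *v w')"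
proof -
  have "bform (metric x) w w' = (transpose (metric x) *v w) \<bullet> w'" by (rule bform_eq_inner)
  also have "transpose (metric x) = metric x" by (simp add: metric_def matrix_transpose_mul)
  also have "(metric x *v w) \<bullet> w' = (coframe (x$3) *v w) \<bullet> (coframe (x$3) *v w')"
    by (simp add: metric_def dot_lmul_matrix flip: matrix_vector_mul_assoc)
  finally show ?thesis .
qed

end

section \<open>Derivations and the soliton equation\<close>

lemma E2_derivation_obtain:
  assumes "E2_derivation D"
  obtains r s where "\<And>y. D y $ 3 = 0"
    and "\<And>y. y $ 3 = 0 \<Longrightarrow> D y = vector [r * y$1 - s * y$2, s * y$1 + r * y$2, 0]"
proof -
  have lin: "linear D" and der: "\<And>u v. D (E2_lie u v) = E2_lie (D u) v + E2_lie u (D v)"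
    using assms by (auto simp: E2_derivation_def)
  have D1: "D (axis 1 1) = E2_lie (D (axis 2 1)) (axis 3 1) + E2_lie (axis 2 1) (D (axis 3 1))"
    and D2: "D (axis 2 1) = E2_lie (D (axis 3 1)) (axis 1 1) + E2_lie (axis 3 1) (D (axis 1 1))"
    by (simp_all flip: der add: E2_brackets)
  have 1: "D (axis 1 1) $ 1 = D (axis 2 1) $ 2 + D (axis 3 1) $ 3"
      "D (axis 1 1) $ 2 = - D (axis 2 1) $ 1" "D (axis 1 1) $ 3 = 0"
    by (subst D1, simp add: E2_lie_eq axis_def)+
  have 2: "D (axis 2 1) $ 2 = D (axis 1 1) $ 1 + D (axis 3 1) $ 3" "D (axis 2 1) $ 3 = 0"
    by (subst D2, simp add: E2_lie_eq axis_def)+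
  \<comment> \<open>The two equations for the diagonal entries on the plane differ only in the sign
    of this entry, so it vanishes.\<close>
  have 3: "D (axis 3 1) $ 3 = 0" using 1(1) 2(1) by simp
  have exp: "D y = y$1 *\<^sub>R D (axis 1 1) + y$2 *\<^sub>R D (axis 2 1) + y$3 *\<^sub>R D (axis 3 1)" for y
    using linear_vec_sum_axis[OF lin, of y] by (simp add: sum_3)
  show thesis
  proof (rule that)
    show "D y $ 3 = 0" for y by (subst exp) (simp add: 1 2 3)
    show "D y = vector [D (axis 1 1) $ 1 * y$1 - D (axis 1 1) $ 2 * y$2,
        D (axis 1 1) $ 2 * y$1 + D (axis 1 1) $ 1 * y$2, 0]" if "y $ 3 = 0" for y
      by (subst exp) (use 1 2 3 that in \<open>simp add: vec_eq_iff forall_3 algebra_simps\<close>)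
  qed
qed

context milnor_frame
begin

lemma steady_soliton_imp_eq:
  assumes "\<alpha> > 0" and riem: "riemannian_metric metric"
    and sol: "E2_derivation (RG_hat \<alpha> metric)"
  shows "a = b"
proof -
  let ?D = "RG_hat \<alpha> metric" and ?f = "\<lambda>k. frame 0 *v axis k 1"
  obtain r s where D3: "\<And>y. ?D y $ 3 = 0"
    and D: "\<And>y. y $ 3 = 0 \<Longrightarrow> ?D y = vector [r * y$1 - s * y$2, s * y$1 + r * y$2, 0]"
    using E2_derivation_obtain[OF sol] by blast
  \<comment> \<open>The frame is orthonormal, so the eigenvalues are the diagonal entries of the
    dual endomorphism in the frame.\<close>
  have key: "\<rho> \<alpha> $ k = (coframe 0 *v ?D (?f k)) $ k" for k
  proof -
    have "\<rho> \<alpha> $ k = bform (RG \<alpha> metric 0) (?f k) (?f k)"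
      using bform_RG_metric[of \<alpha> 0 "axis k 1" "axis k 1"] by (simp add: axis_def if_distrib cong: if_cong)
    also have "\<dots> = bform (metric 0) (?D (?f k)) (?f k)"
      by (rule RG_hat_eq[OF riem, symmetric])
    also have "\<dots> = (coframe 0 *v ?D (?f k)) $ k"
      by (simp add: bform_metric inner_axis)
    finally show ?thesis .
  qed
  have f: "?f 1 = vector [cos \<phi> / m, sin \<phi> / m, 0]" "?f 2 = vector [- (sin \<phi> / n), cos \<phi> / n, 0]"
    by (simp_all add: frame_def vec_eq_iff forall_3 matrix_vector_mult_def sum_3 axis_def)
  have "\<rho> \<alpha> $ 3 = 0"
    unfolding key using D3[of "?f 3"] by (simp add: coframe_def matrix_vector_mult_def sum_3)
  \<comment> \<open>The first two frame vectors are orthogonal in the Euclidean sense as well, so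
    the \<open>s\<close> part of the derivation is purely off-diagonal in them.\<close>
  moreover have "\<rho> \<alpha> $ 1 = r" "\<rho> \<alpha> $ 2 = r"
  proof -
    have *: "r * (cos \<phi> * cos \<phi>) = r - r * (sin \<phi> * sin \<phi>)"
      using sin_cos_squared_add[of \<phi>] by algebra
    show "\<rho> \<alpha> $ 1 = r" "\<rho> \<alpha> $ 2 = r"
      unfolding key f using m n
      by (simp_all add: D coframe_def matrix_vector_mult_def sum_3 field_simps)
         (simp_all add: * algebra_simps)
  qed
  ultimately show ?thesis using eq_if_\<rho> \<open>\<alpha> > 0\<close> by simp
qed

end

section \<open>Existence of a Milnor frame\<close>

lemma bform_axis: "bform A (axis i 1) (axis j 1) = A $ i $ j"
  by (simp add: bform_eq_inner inner_axis matrix_vector_mult_basis column_def transpose_def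
      del: transpose_matrix_vector)

lemma linear_bform: "linear (bform A u)" "linear (\<lambda>u. bform A u v)"
  unfolding bform_eq_inner
  by (rule linearI; simp add: inner_add_left inner_add_right matrix_vector_right_distrib matrix_vector_mult_scaleR)+

text \<open>A left invariant metric is determined by its value at the neutral element, and left
  translation by \<open>x\<close> rotates the frame by the angle \<open>x $ 3\<close>.\<close>

lemma (in milnor_frame) eq_metric_if_left_invariant:
  assumes inv: "E2_left_invariant_metric g"
    and g0: "\<And>y y'. bform (g 0) y y' = (coframe 0 *v y) \<bullet> (coframe 0 *v y')"
  shows "g = metric"
proof
  fix x :: "real^3"
  \<comment> \<open>The inverse of the differential of left translation by \<open>x\<close>: the
    rotation by \<open>- x $ 3\<close>.\<close>
  define rot :: "real^3 \<Rightarrow> real^3" where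
    "rot w = vector [cos (x$3) * w$1 + sin (x$3) * w$2, cos (x$3) * w$2 - sin (x$3) * w$1, w$3]" for w
  have rot: "E2_dL x 0 (rot w) = w" for w
  proof -
    have "cos (x$3) * (cos (x$3) * w$1 + sin (x$3) * w$2) - sin (x$3) * (cos (x$3) * w$2 - sin (x$3) * w$1) = w$1"
      "sin (x$3) * (cos (x$3) * w$1 + sin (x$3) * w$2) + cos (x$3) * (cos (x$3) * w$2 - sin (x$3) * w$1) = w$2"
      using sin_cos_squared_add[of "x$3"] by algebra+
    then show ?thesis by (simp add: E2_dL_eq rot_def vec_eq_iff forall_3)
  qed
  have co: "coframe 0 *v rot w = coframe (x$3) *v w" for w
    by (simp add: coframe_def rot_def vec_eq_iff forall_3 matrix_vector_mult_def sum_3 cos_add sin_add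
        algebra_simps)
  have "bform (g x) w w' = bform (metric x) w w'" for w w'
  proof -
    have "bform (g (E2_mult x 0)) (E2_dL x 0 (rot w)) (E2_dL x 0 (rot w')) = bform (g 0) (rot w) (rot w')"
      using inv unfolding E2_left_invariant_metric_def by blast
    then show ?thesis by (simp add: rot E2_mult_0 g0 co bform_metric)
  qed
  then show "g x = metric x" by (simp add: vec_eq_iff flip: bform_axis)
qed

text \<open>A quarter turn replaces the two vectors by the second and minus the first, so the
  pairing changes sign and has a zero in between.\<close>

lemma ex_orthogonal_rotation:
  fixes A :: "real^3^3"
  assumes "\<And>u v. bform A u v = bform A v u"
  shows "\<exists>\<phi>. bform A (vector [cos \<phi>, sin \<phi>, 0]) (vector [- sin \<phi>, cos \<phi>, 0]) = 0"
proof -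
  define h where "h \<phi> = bform A (vector [cos \<phi>, sin \<phi>, 0]) (vector [- sin \<phi>, cos \<phi>, 0])" for \<phi>
  have sym: "A $ 1 $ 2 = A $ 2 $ 1" using assms[of "axis 1 1" "axis 2 1"] by (simp add: bform_axis)
  have cont: "continuous_on S h" for S
    unfolding h_def bform_def sum_3 vector_3 by (intro continuous_intros)
  have "h 0 = A $ 1 $ 2" "h (pi/2) = - A $ 1 $ 2"
    by (simp_all add: h_def bform_def sum_3 sym)
  then have "\<exists>\<phi>. h \<phi> = 0"
    using IVT'[of h 0 0 "pi/2", OF _ _ _ cont] IVT2'[of h "pi/2" 0 0, OF _ _ _ cont]
    by (cases "A $ 1 $ 2 \<ge> 0") auto
  then show ?thesis unfolding h_def .
qed

lemma E2_left_invariant_metric_obtain_milnor_frame: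
  assumes inv: "E2_left_invariant_metric g"
  obtains m n z u v \<phi> where "milnor_frame m n z" and "g = milnor_frame.metric m n z u v \<phi>"
proof -
  let ?g = "bform (g 0)"
  have sym: "?g y y' = ?g y' y" and pos: "y \<noteq> 0 \<Longrightarrow> ?g y y > 0" for y y'
    using inv by (auto simp: E2_left_invariant_metric_def riemannian_metric_def)
  obtain \<phi> where ort: "?g (vector [cos \<phi>, sin \<phi>, 0]) (vector [- sin \<phi>, cos \<phi>, 0]) = 0"
    using ex_orthogonal_rotation sym by blast
  define b1 b2 b3 :: "real^3" where
    "b1 = vector [cos \<phi>, sin \<phi>, 0]" and "b2 = vector [- sin \<phi>, cos \<phi>, 0]" and "b3 = axis 3 1"
  \<comment> \<open>Gram-Schmidt: \<open>b3\<close> minus its projections to \<open>b1\<close> and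
    \<open>b2\<close>.\<close>
  define f :: "real^3" where "f = b3 - (?g b1 b3 / ?g b1 b1) *\<^sub>R b1 - (?g b2 b3 / ?g b2 b2) *\<^sub>R b2"
  have "sin \<phi> \<noteq> 0 \<or> cos \<phi> \<noteq> 0" using sin_zero_abs_cos_one by force
  then have "b1 \<noteq> 0" "b2 \<noteq> 0" by (auto simp: b1_def b2_def vec_eq_iff forall_3)
  moreover have "f $ 3 = 1" by (simp add: f_def b1_def b2_def b3_def)
  then have "f \<noteq> 0" by auto
  ultimately have p: "?g b1 b1 > 0" "?g b2 b2 > 0" "?g f f > 0" using pos by auto
  \<comment> \<open>The lengths of \<open>b1\<close> and \<open>b2\<close>, and the third component
    of the unit vector along \<open>f\<close>, as \<open>f $ 3 = 1\<close>.\<close>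
  define m n z where "m = sqrt (?g b1 b1)" and "n = sqrt (?g b2 b2)" and "z = 1 / sqrt (?g f f)"
  define u v where "u = - z * (?g b1 b3 / ?g b1 b1)" and "v = - z * (?g b2 b3 / ?g b2 b2)"
  interpret milnor_frame m n z u v \<phi>
    by unfold_locales (use p in \<open>simp_all add: m_def n_def z_def\<close>)
  note lin = linear_add[OF linear_bform(1)] linear_add[OF linear_bform(2)]
    linear_diff[OF linear_bform(1)] linear_diff[OF linear_bform(2)]
    linear_cmul[OF linear_bform(1)] linear_cmul[OF linear_bform(2)]
  have ort': "?g b1 b2 = 0" "?g b2 b1 = 0"
    using ort sym[of b2 b1] by (simp_all only: b1_def b2_def)
  have ortf: "?g b1 f = 0" "?g b2 f = 0"
    using p(1,2) by (simp_all add: f_def lin ort')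
  then have ortf': "?g f b1 = 0" "?g f b2 = 0"
    by (simp_all only: sym[of f b1] sym[of f b2])
  have zf: "z *\<^sub>R f = z *\<^sub>R b3 + u *\<^sub>R b1 + v *\<^sub>R b2"
    by (simp add: f_def u_def v_def scaleR_diff_right)
  have "frame 0 *v w = (w$1 / m) *\<^sub>R b1 + (w$2 / n) *\<^sub>R b2 + w$3 *\<^sub>R (z *\<^sub>R f)" for w
    unfolding zf
    by (simp add: frame_def b1_def b2_def b3_def vec_eq_iff forall_3 axis_def
        matrix_vector_mult_def sum_3 algebra_simps)
  then have fr: "frame 0 *v w = (w$1 / m) *\<^sub>R b1 + (w$2 / n) *\<^sub>R b2 + (w$3 * z) *\<^sub>R f" for w
    by simp
  have sq: "?g b1 b1 = m * m" "?g b2 b2 = n * n" "?g f f = 1 / (z * z)"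
    using p by (simp_all add: m_def n_def z_def)
  have on: "?g (frame 0 *v w) (frame 0 *v w') = w \<bullet> w'" for w w'
    unfolding fr lin ort' ortf ortf' sq using m n z by (simp add: inner_vec_def sum_3)
  have "?g y y' = (coframe 0 *v y) \<bullet> (coframe 0 *v y')" for y y'
    using on[of "coframe 0 *v y" "coframe 0 *v y'"] by simp
  from eq_metric_if_left_invariant[OF inv this] milnor_frame_axioms show thesis
    by (rule that[rotated])
qed

section \<open>Flat metrics are fixed points and steady solitons\<close>

lemma flat_riemann_up:
  assumes "riemannian_metric g" "flat g"
  shows "riemann_up g i j k l x = 0"
proof -
  \<comment> \<open>Flatness concerns the lowered tensor, while \<open>Rc\<close> uses
    \<open>riemann_up\<close>. Pairing the vector \<open>w\<close> with itself and using
    definiteness bridges the two.\<close>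
  define w :: "real^'a" where "w = (\<chi> m. riemann_up g i j k m x)"
  have "bform (g x) w w = (\<Sum>m\<in>UNIV. Rm g x i j k m * w $ m)"
    unfolding bform_def Rm_def sum_distrib_right
    by (subst sum.swap) (simp add: w_def ac_simps)
  also have "\<dots> = 0" using assms(2) by (simp add: flat_def)
  finally have "w = 0" using assms(1) unfolding riemannian_metric_def by (metis less_irrefl)
  then show ?thesis by (simp add: w_def vec_eq_iff)
qed

lemma flat_imp_fixed_point:
  assumes "riemannian_metric g" "flat g"
  shows "RG2_fixed_point \<alpha> g"
proof -
  have "Rc g x = 0" "Rm2 g x = 0" for x
    using flat_riemann_up[OF assms] assms(2) by (simp_all add: Rc_def Rm2_def flat_def vec_eq_iff)
  then show ?thesis by (simp add: RG2_fixed_point_def RG_def)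
qed

lemma fixed_point_imp_steady_soliton:
  assumes riem: "riemannian_metric g" and "RG2_fixed_point \<alpha> g"
  shows "E2_steady_algebraic_soliton \<alpha> g"
proof -
  have "RG_hat \<alpha> g u = 0" for u
  proof -
    have "bform (g 0) (RG_hat \<alpha> g u) (RG_hat \<alpha> g u) = 0"
      unfolding RG_hat_eq[OF riem] using assms(2) by (simp add: RG2_fixed_point_def bform_def)
    then show ?thesis using riem unfolding riemannian_metric_def by (metis less_irrefl)
  qed
  then have "RG_hat \<alpha> g = (\<lambda>_. 0)" by blast
  then show ?thesis
    by (simp add: E2_steady_algebraic_soliton_def E2_algebraic_soliton_def E2_derivation_def
        E2_lie_eq vec_eq_iff forall_3 linear_zero)
qed

theorem theorem3p6:
  fixes \<alpha> :: real
  assumes "\<alpha> > 0"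
  shows "(\<forall>g. E2_left_invariant_metric g \<and> flat g \<longrightarrow>
              RG2_fixed_point \<alpha> g \<and> E2_steady_algebraic_soliton \<alpha> g) \<and>
         (\<forall>g. E2_left_invariant_metric g \<and> E2_steady_algebraic_soliton \<alpha> g \<longrightarrow> flat g)"
proof (intro conjI allI impI; elim conjE)
  fix g assume inv: "E2_left_invariant_metric g"
  then have riem: "riemannian_metric g" by (simp add: E2_left_invariant_metric_def)
  {
    assume "flat g"
    with riem show "RG2_fixed_point \<alpha> g" by (rule flat_imp_fixed_point)
    with riem show "E2_steady_algebraic_soliton \<alpha> g" by (rule fixed_point_imp_steady_soliton)
  next
    assume sol: "E2_steady_algebraic_soliton \<alpha> g"
    obtain m n z u v \<phi> where mf: "milnor_frame m n z" and g: "g = milnor_frame.metric m n z u v \<phi>"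
      using E2_left_invariant_metric_obtain_milnor_frame[OF inv] .
    interpret milnor_frame m n z u v \<phi> by (rule mf)
    have "E2_derivation (RG_hat \<alpha> metric)"
      using sol by (simp add: E2_steady_algebraic_soliton_def E2_algebraic_soliton_def g)
    then show "flat g"
      using steady_soliton_imp_eq assms riem flat_metric by (simp add: g)
  }
qed

end
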